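(* Let $(M,F)$ be a Finsler surface with nonflat geodesic spray $S$, and let $(H,S,V,\mathcal{C})$ be its Berwald frame. Let $\mathcal{F}:=H(\mathcal{I})+V(\mathcal{J})$. If $V(\rho)=0$, then: (1) $\mathcal{F}$ is a first integral of the geodesic flow, that is $S(\mathcal{F})=0$; (2) $S(\mathcal{J})=-\mathcal{I}\,\rho$.
   Context: $M$ is a $2$-dimensional smooth manifold, $\mathcal{T}M$ its tangent bundle with the zero section removed, with induced coordinates $(x^i,y^i)$; $J=\frac{\partial}{\partial y^i}\otimes dx^i$ is the almost-tangent structure and $\mathcal{C}=y^i\frac{\partial}{\partial y^i}$ the Liouville vector field. $F:TM\to\mathbb{R}$ is a Finsler function: smooth and positive on $\mathcal{T}M$, zero exactly on the zero section, positively $1$-homogeneous in $y$, with $g_{ij}=\frac12\frac{\partial^2F^2}{\partial y^i\partial y^j}$ of maximal rank on $\mathcal{T}M$. $S=y^i\frac{\partial}{\partial x^i}-2G^i\frac{\partial}{\partial y^i}$ is its geodesic spray, and "horizontal" refers to the image of the projector $h=\frac12(Id+[J,S])$ (Frölicher–Nijenhuis bracket). With $G^i_j=\partial G^i/\partial y^j$, the Jacobi endomorphism is $\Phi=\big(2\frac{\partial G^i}{\partial x^j}-S(G^i_j)-G^i_kG^k_j\big)\frac{\partial}{\partial y^i}\otimes dx^j$; in dimension $2$ one has $\Phi=K(F^2J-F\,d_JF\otimes\mathcal{C})$, where $K\in C^\infty(\mathcal{T}M)$ is the flag curvature; the Ricci scalar is $\rho=KF^2$. $S$ is nonflat: $K$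 vanishes nowhere on $\mathcal{T}M$. Berwald frame: $H$ is a horizontal vector field on $\mathcal{T}M$ with $[\mathcal{C},H]=H$, $d_JF(H)=0$, $V:=JH$, normalized so that $[S,H]=\rho V$, $[V,S]=H$, $[H,V]=S+\mathcal{I}H+\mathcal{J}V$ with $\mathcal{J}=S(\mathcal{I})$. Here $\mathcal{I}$ is the main (Cartan) scalar and $\mathcal{J}$ the Landsberg scalar. $H,S,V$ annihilate $F$. *)

theory Defs
  imports "HOL-Analysis.Analysis"
begin

section \<open>Smooth maps and smooth manifolds\<close>

text \<open>Meant for open \<open>U\<close> in a finite-dimensional space: all iterated directional derivatives
  exist, are differentiable and are continuous.\<close>

primrec Ck_on :: "nat \<Rightarrow> 'a::real_normed_vector set \<Rightarrow> ('a \<Rightarrow> 'b::real_normed_vector) \<Rightarrow> bool" where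
  "Ck_on 0 U f \<longleftrightarrow> continuous_on U f"
| "Ck_on (Suc k) U f \<longleftrightarrow>
     (\<forall>x\<in>U. f differentiable (at x)) \<and>
     (\<forall>v. Ck_on k U (\<lambda>x. frechet_derivative f (at x) v))"

definition smooth_on :: "'a::real_normed_vector set \<Rightarrow> ('a \<Rightarrow> 'b::real_normed_vector) \<Rightarrow> bool" where
  "smooth_on U f \<longleftrightarrow> (\<forall>k. Ck_on k U f)"

text \<open>A chart \<open>(U, \<phi>)\<close>; the values of \<open>\<phi>\<close> outside \<open>U\<close> are irrelevant.\<close>

type_synonym ('a, 'e) chart = "'a set \<times> ('a \<Rightarrow> 'e)"

definition chart_inv :: "('a, 'e) chart \<Rightarrow> 'e \<Rightarrow> 'a" where
  "chart_inv c = inv_into (fst c) (snd c)"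

definition charted_space :: "('a, 'e) chart set \<Rightarrow> 'a set" where
  "charted_space A = (\<Union>c\<in>A. fst c)"

text \<open>The dimension is that of the model space \<open>'e\<close>. The atlas \<open>A\<close> need not be maximal; every notion
  below depends only on the smooth structure it generates.\<close>

definition smooth_manifold :: "'a topology \<Rightarrow> ('a, 'e::euclidean_space) chart set \<Rightarrow> bool" where
  "smooth_manifold M A \<longleftrightarrow>
     Hausdorff_space M \<and> second_countable M \<and> charted_space A = topspace M \<and>
     (\<forall>c\<in>A. openin M (fst c) \<and> open (snd c ` fst c) \<and>
        homeomorphic_map (subtopology M (fst c)) (top_of_set (snd c ` fst c)) (snd c)) \<and>
     (\<forall>c\<in>A. \<forall>d\<in>A. smooth_on (snd c ` (fst c \<inter> fst d)) (snd d \<circ> chart_inv c))"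

definition smooth_fun :: "('a, 'e::euclidean_space) chart set \<Rightarrow> ('a \<Rightarrow> real) \<Rightarrow> bool" where
  "smooth_fun A f \<longleftrightarrow> (\<forall>c\<in>A. smooth_on (snd c ` fst c) (f \<circ> chart_inv c))"


section \<open>Tangent vectors and vector fields\<close>

text \<open>A tangent vector at \<open>p\<close> is the family of its coordinate representations in the charts around
  \<open>p\<close>, related by the derivatives of the transition maps; it is set to 0 at all other charts.\<close>

type_synonym ('a, 'e) tvec = "('a, 'e) chart \<Rightarrow> 'e"

definition tangent_space :: "('a, 'e::euclidean_space) chart set \<Rightarrow> 'a \<Rightarrow> ('a, 'e) tvec set" where
  "tangent_space A p = {v.
     (\<forall>c\<in>A. \<forall>d\<in>A. p \<in> fst c \<and> p \<in> fst d \<longrightarrow>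
        v d = frechet_derivative (snd d \<circ> chart_inv c) (at (snd c p)) (v c)) \<and>
     (\<forall>c. c \<notin> A \<or> p \<notin> fst c \<longrightarrow> v c = 0)}"

text \<open>\<open>differential A f p v\<close> is $df_p(v)$. The choice of the chart is immaterial for
  \<open>v \<in> tangent_space A p\<close> and \<open>f\<close> differentiable at \<open>p\<close>.\<close>

definition differential ::
    "('a, 'e::euclidean_space) chart set \<Rightarrow> ('a \<Rightarrow> real) \<Rightarrow> 'a \<Rightarrow> ('a, 'e) tvec \<Rightarrow> real" where
  "differential A f p v =
     (let c = (SOME c. c \<in> A \<and> p \<in> fst c)
      in frechet_derivative (f \<circ> chart_inv c) (at (snd c p)) (v c))"

definition field_rep :: "('a \<Rightarrow> ('a, 'e) tvec) \<Rightarrow> ('a, 'e) chart \<Rightarrow> 'e \<Rightarrow> 'e" where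
  "field_rep X c = (\<lambda>z. X (chart_inv c z) c)"

definition vector_field ::
    "('a, 'e::euclidean_space) chart set \<Rightarrow> ('a \<Rightarrow> ('a, 'e) tvec) \<Rightarrow> bool" where
  "vector_field A X \<longleftrightarrow>
     (\<forall>p\<in>charted_space A. X p \<in> tangent_space A p) \<and>
     (\<forall>c\<in>A. smooth_on (snd c ` fst c) (field_rep X c))"

definition field_deriv ::
    "('a, 'e::euclidean_space) chart set \<Rightarrow> ('a \<Rightarrow> ('a, 'e) tvec) \<Rightarrow> ('a \<Rightarrow> real) \<Rightarrow> 'a \<Rightarrow> real" where
  "field_deriv A X f = (\<lambda>p. differential A f p (X p))"

text \<open>In coordinates $[X,Y]^a = X(Y^a) - Y(X^a)$.\<close>

definition lie_bracket ::
    "('a, 'e::euclidean_space) chart set \<Rightarrow> ('a \<Rightarrow> ('a, 'e) tvec) \<Rightarrow> ('a \<Rightarrow> ('a, 'e) tvec) \<Rightarrow>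
     'a \<Rightarrow> ('a, 'e) tvec" where
  "lie_bracket A X Y = (\<lambda>p c. if c \<in> A \<and> p \<in> fst c
     then frechet_derivative (field_rep Y c) (at (snd c p)) (X p c)
        - frechet_derivative (field_rep X c) (at (snd c p)) (Y p c)
     else 0)"

text \<open>The Froelicher-Nijenhuis bracket $[L,S]$ of a vector-valued 1-form $L$ (given by its action on
  vector fields) and a vector field $S$: $[L,S](X) = [LX,S] - L[X,S]$.\<close>

definition fn_bracket ::
    "('a, 'e::euclidean_space) chart set \<Rightarrow>
     (('a \<Rightarrow> ('a, 'e) tvec) \<Rightarrow> 'a \<Rightarrow> ('a, 'e) tvec) \<Rightarrow> ('a \<Rightarrow> ('a, 'e) tvec) \<Rightarrow>
     ('a \<Rightarrow> ('a, 'e) tvec) \<Rightarrow> 'a \<Rightarrow> ('a, 'e) tvec" where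
  "fn_bracket A L S X = (\<lambda>p c. lie_bracket A (L X) S p c - L (lie_bracket A X S) p c)"


section \<open>The tangent bundle of a surface\<close>

type_synonym 'a tpoint = "'a \<times> ('a, real^2) tvec"
type_synonym coords = "(real^2) \<times> (real^2)"
type_synonym 'a tfield = "'a tpoint \<Rightarrow> ('a tpoint, coords) tvec"

definition tangent_bundle :: "('a, real^2) chart set \<Rightarrow> 'a tpoint set" where
  "tangent_bundle A = {(p, v). p \<in> charted_space A \<and> v \<in> tangent_space A p}"

text \<open>The induced coordinates $(x^i,y^i)$, restricted to the complement of the zero section.\<close>

definition induced_chart ::
    "('a, real^2) chart set \<Rightarrow> ('a, real^2) chart \<Rightarrow> ('a tpoint, coords) chart" where
  "induced_chart A c =
     ({(p, v) \<in> tangent_bundle A. p \<in> fst c \<and> v \<noteq> (\<lambda>_. 0)}, \<lambda>(p, v). (snd c p, v c))"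

definition slit_atlas :: "('a, real^2) chart set \<Rightarrow> ('a tpoint, coords) chart set" where
  "slit_atlas A = induced_chart A ` A"

definition slit_bundle :: "('a, real^2) chart set \<Rightarrow> 'a tpoint set" where
  "slit_bundle A = charted_space (slit_atlas A)"

definition pd_x :: "2 \<Rightarrow> (coords \<Rightarrow> real) \<Rightarrow> coords \<Rightarrow> real" where
  "pd_x i f z = frechet_derivative f (at z) (axis i 1, 0)"

definition pd_y :: "2 \<Rightarrow> (coords \<Rightarrow> real) \<Rightarrow> coords \<Rightarrow> real" where
  "pd_y i f z = frechet_derivative f (at z) (0, axis i 1)"

text \<open>The almost-tangent structure $J = \partial_{y^i} \otimes dx^i$, on single tangent vectors.\<close>

definition vert :: "('a tpoint, coords) tvec \<Rightarrow> ('a tpoint, coords) tvec" where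
  "vert w = (\<lambda>\<kappa>. (0, fst (w \<kappa>)))"

definition vert_field :: "'a tfield \<Rightarrow> 'a tfield" where
  "vert_field X = (\<lambda>u. vert (X u))"

definition liouville :: "('a, real^2) chart set \<Rightarrow> 'a tfield" where
  "liouville A = (\<lambda>u \<kappa>. if \<kappa> \<in> slit_atlas A \<and> u \<in> fst \<kappa> then (0, snd (snd \<kappa> u)) else 0)"

text \<open>$d_J f(w) = df(Jw)$.\<close>

definition d_J ::
    "('a, real^2) chart set \<Rightarrow> ('a tpoint \<Rightarrow> real) \<Rightarrow> 'a tpoint \<Rightarrow> ('a tpoint, coords) tvec \<Rightarrow> real" where
  "d_J A f u w = differential (slit_atlas A) f u (vert w)"


section \<open>Finsler functions, geodesic spray, flag curvature\<close>

definition metric_tensor :: "('a tpoint, coords) chart \<Rightarrow> ('a tpoint \<Rightarrow> real) \<Rightarrow> coords \<Rightarrow> real^2^2" where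
  "metric_tensor \<kappa> F z = (\<chi> i j. (1/2) * pd_y i (pd_y j (\<lambda>z. (F (chart_inv \<kappa> z))\<^sup>2)) z)"

definition finsler_function :: "('a, real^2) chart set \<Rightarrow> ('a tpoint \<Rightarrow> real) \<Rightarrow> bool" where
  "finsler_function A F \<longleftrightarrow>
     smooth_fun (slit_atlas A) F \<and>
     (\<forall>u\<in>slit_bundle A. F u > 0) \<and>
     (\<forall>(p, v)\<in>tangent_bundle A. F (p, v) = 0 \<longleftrightarrow> v = (\<lambda>_. 0)) \<and>
     (\<forall>(p, v)\<in>tangent_bundle A. \<forall>t>0. F (p, \<lambda>c. t *\<^sub>R v c) = t * F (p, v)) \<and>
     (\<forall>\<kappa>\<in>slit_atlas A. \<forall>z\<in>snd \<kappa> ` fst \<kappa>. rank (metric_tensor \<kappa> F z) = 2)"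

text \<open>The Euler-Lagrange equations of $F^2$ give
  $G^i = \frac14 g^{ij}\left(y^k \frac{\partial^2 F^2}{\partial x^k \partial y^j}
    - \frac{\partial F^2}{\partial x^j}\right)$.\<close>

definition geodesic_coeff :: "('a tpoint, coords) chart \<Rightarrow> ('a tpoint \<Rightarrow> real) \<Rightarrow> coords \<Rightarrow> real^2" where
  "geodesic_coeff \<kappa> F z =
     (let E = (\<lambda>z. (F (chart_inv \<kappa> z))\<^sup>2)
      in (1/4) *\<^sub>R (matrix_inv (metric_tensor \<kappa> F z) *v
           (\<chi> j. (\<Sum>k\<in>UNIV. snd z $ k * pd_x k (pd_y j E) z) - pd_x j E z)))"

definition geodesic_spray :: "('a, real^2) chart set \<Rightarrow> ('a tpoint \<Rightarrow> real) \<Rightarrow> 'a tfield \<Rightarrow> bool" where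
  "geodesic_spray A F S \<longleftrightarrow>
     vector_field (slit_atlas A) S \<and>
     (\<forall>\<kappa>\<in>slit_atlas A. \<forall>z\<in>snd \<kappa> ` fst \<kappa>.
        field_rep S \<kappa> z = (snd z, - 2 *\<^sub>R geodesic_coeff \<kappa> F z))"

text \<open>The horizontal projector $h = \frac12(\mathrm{Id} + [J,S])$, and membership in its image.\<close>

definition hproj :: "('a, real^2) chart set \<Rightarrow> 'a tfield \<Rightarrow> 'a tfield \<Rightarrow> 'a tfield" where
  "hproj A S X = (\<lambda>u \<kappa>. (1/2) *\<^sub>R (X u \<kappa> + fn_bracket (slit_atlas A) vert_field S X u \<kappa>))"

definition horizontal :: "('a, real^2) chart set \<Rightarrow> 'a tfield \<Rightarrow> 'a tfield \<Rightarrow> bool" where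
  "horizontal A S Y \<longleftrightarrow>
     (\<exists>X. vector_field (slit_atlas A) X \<and> (\<forall>u\<in>slit_bundle A. Y u = hproj A S X u))"

text \<open>For a spray $S = y^i \partial_{x^i} - 2 G^i \partial_{y^i}$, the coefficients
  $G^i$, $G^i_j = \partial G^i/\partial y^j$, and the components
  $2 \partial G^i/\partial x^j - S(G^i_j) - G^i_k G^k_j$ of the Jacobi endomorphism.\<close>

definition spray_coeff :: "'a tfield \<Rightarrow> ('a tpoint, coords) chart \<Rightarrow> 2 \<Rightarrow> coords \<Rightarrow> real" where
  "spray_coeff S \<kappa> i z = - (1/2) * snd (field_rep S \<kappa> z) $ i"

definition connection_coeff :: "'a tfield \<Rightarrow> ('a tpoint, coords) chart \<Rightarrow> 2 \<Rightarrow> 2 \<Rightarrow> coords \<Rightarrow> real" where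
  "connection_coeff S \<kappa> i j = pd_y j (spray_coeff S \<kappa> i)"

definition jacobi_matrix :: "'a tfield \<Rightarrow> ('a tpoint, coords) chart \<Rightarrow> coords \<Rightarrow> real^2^2" where
  "jacobi_matrix S \<kappa> z = (\<chi> i j.
     2 * pd_x j (spray_coeff S \<kappa> i) z
     - frechet_derivative (connection_coeff S \<kappa> i j) (at z) (field_rep S \<kappa> z)
     - (\<Sum>k\<in>UNIV. connection_coeff S \<kappa> i k z * connection_coeff S \<kappa> k j z))"

definition jacobi_endo :: "('a, real^2) chart set \<Rightarrow> 'a tfield \<Rightarrow> 'a tpoint \<Rightarrow>
    ('a tpoint, coords) tvec \<Rightarrow> ('a tpoint, coords) tvec" where
  "jacobi_endo A S u w = (\<lambda>\<kappa>. if \<kappa> \<in> slit_atlas A \<and> u \<in> fst \<kappa>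
     then (0, jacobi_matrix S \<kappa> (snd \<kappa> u) *v fst (w \<kappa>)) else 0)"

text \<open>$K$ is the flag curvature: $\Phi = K(F^2 J - F\, d_J F \otimes \mathcal{C})$.\<close>

definition flag_curvature ::
    "('a, real^2) chart set \<Rightarrow> ('a tpoint \<Rightarrow> real) \<Rightarrow> 'a tfield \<Rightarrow> ('a tpoint \<Rightarrow> real) \<Rightarrow> bool" where
  "flag_curvature A F S K \<longleftrightarrow>
     smooth_fun (slit_atlas A) K \<and>
     (\<forall>u\<in>slit_bundle A. \<forall>w\<in>tangent_space (slit_atlas A) u.
        jacobi_endo A S u w =
          (\<lambda>\<kappa>. K u *\<^sub>R ((F u)\<^sup>2 *\<^sub>R vert w \<kappa> - (F u * d_J A F u w) *\<^sub>R liouville A u \<kappa>)))"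

definition ricci_scalar :: "('a tpoint \<Rightarrow> real) \<Rightarrow> ('a tpoint \<Rightarrow> real) \<Rightarrow> 'a tpoint \<Rightarrow> real" where
  "ricci_scalar F K u = K u * (F u)\<^sup>2"


section \<open>Berwald frame\<close>

text \<open>\<open>berwald_frame A F S K H \<I> \<J>\<close>: the fields \<open>(H, S, V, \<C>)\<close> with $V = JH$ form a Berwald frame
  with main scalar \<open>\<I>\<close> and Landsberg scalar \<open>\<J>\<close>.\<close>

definition berwald_frame ::
    "('a, real^2) chart set \<Rightarrow> ('a tpoint \<Rightarrow> real) \<Rightarrow> 'a tfield \<Rightarrow> ('a tpoint \<Rightarrow> real) \<Rightarrow>
     'a tfield \<Rightarrow> ('a tpoint \<Rightarrow> real) \<Rightarrow> ('a tpoint \<Rightarrow> real) \<Rightarrow> bool" where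
  "berwald_frame A F S K H \<I> \<J> \<longleftrightarrow>
     (let T = slit_atlas A; V = vert_field H; C = liouville A; \<rho> = ricci_scalar F K in
        vector_field T H \<and> horizontal A S H \<and> smooth_fun T \<I> \<and>
        (\<forall>u\<in>slit_bundle A.
           lie_bracket T C H u = H u \<and>
           d_J A F u (H u) = 0 \<and>
           lie_bracket T S H u = (\<lambda>\<kappa>. \<rho> u *\<^sub>R V u \<kappa>) \<and>
           lie_bracket T V S u = H u \<and>
           lie_bracket T H V u = (\<lambda>\<kappa>. S u \<kappa> + \<I> u *\<^sub>R H u \<kappa> + \<J> u *\<^sub>R V u \<kappa>) \<and>
           \<J> u = field_deriv T S \<I> u \<and>
           (\<forall>a b c d. (\<forall>\<kappa>. a *\<^sub>R H u \<kappa> + b *\<^sub>R S u \<kappa> + c *\<^sub>R V u \<kappa> + d *\<^sub>R C u \<kappa> = 0)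
              \<longrightarrow> a = 0 \<and> b = 0 \<and> c = 0 \<and> d = 0)))"

text \<open>First integrals of the geodesic flow are smooth by definition, so that \<open>S(f) = 0\<close> is not a
  statement about an unspecified value of \<^const>\<open>frechet_derivative\<close>.\<close>

definition first_integral :: "('a, real^2) chart set \<Rightarrow> 'a tfield \<Rightarrow> ('a tpoint \<Rightarrow> real) \<Rightarrow> bool" where
  "first_integral A S f \<longleftrightarrow>
     smooth_fun (slit_atlas A) f \<and> (\<forall>u\<in>slit_bundle A. field_deriv (slit_atlas A) S f u = 0)"

end

theory Submission
  imports Defs
begin

text \<open>
  Everything follows from the Jacobi identity and the commutator rule \<open>[X,Y] f = X(Y f) - Y(X f)\<close>
  applied to the structure equations of the Berwald frame.

  In the cyclic sum of \<open>[S,[H,V]]\<close>, \<open>[H,[V,S]]\<close> and \<open>[V,[S,H]]\<close>, the first term is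
  \<open>[S, S + \<I>H + \<J>V] = S(\<I>) H + \<I>\<rho> V + S(\<J>) V - \<J> H\<close>, the second is \<open>[H,H] = 0\<close> and the third is
  \<open>[V, \<rho>V] = V(\<rho>) V = 0\<close>. Since \<open>\<J> = S(\<I>)\<close>, what remains is \<open>(\<I>\<rho> + S(\<J>)) V = 0\<close>, and \<open>V\<close> belongs to
  a frame; this gives \<open>S(\<J>) = - \<I>\<rho>\<close>. For the first integral, the commutators of \<open>S\<close> with \<open>H\<close> and \<open>V\<close> give
  \<open>S(H(\<I>)) = H(S(\<I>)) + [S,H](\<I>) = H(\<J>) + \<rho> V(\<I>)\<close> and
  \<open>S(V(\<J>)) = V(S(\<J>)) + [S,V](\<J>) = - V(\<I>\<rho>) - H(\<J>)\<close>; with \<open>V(\<rho>) = 0\<close> the sum of the two is zero.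
  These computations are \<open>structure_equations_Jacobi\<close> and \<open>structure_equations_first_integral\<close>,
  carried out for vector fields on an open set of a Euclidean space.

  Two things are needed to support them. One is the symmetry of second derivatives, which is what lies
  behind the commutator rule (\<open>derive_along_commutator\<close>) and, through it, the Jacobi identity
  (\<open>bracket_Jacobi\<close>). The other is the passage between the slit tangent bundle and one fixed chart:
  derivatives of functions along fields must not depend on the chart (\<open>differential_in_chart\<close>,
  \<open>field_deriv_in_chart\<close>). This requires that the induced charts have open images and differentiable
  transition maps \<open>(x, y) \<mapsto> (\<tau> x, D\<tau>(x) y)\<close> (\<open>compatible_slit_atlas\<close>), and that \<open>V = JH\<close> is again a
  vector field (\<open>vector_field_vert_field\<close>).
\<close>


section \<open>Calculus of smooth maps\<close>

lemma frechet_derivative_eq: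
  "(f has_derivative f') (at x) \<Longrightarrow> frechet_derivative f (at x) = f'"
  by (metis frechet_derivative_at)

lemma has_frechet_derivative:
  "f differentiable (at x) \<Longrightarrow> (f has_derivative frechet_derivative f (at x)) (at x)"
  by (simp add: frechet_derivative_works)

lemma frechet_derivative_cong_on_open:
  assumes "open U" "x \<in> U" "\<And>y. y \<in> U \<Longrightarrow> f y = g y"
  shows "frechet_derivative f (at x) = frechet_derivative g (at x)"
proof -
  have "(f has_derivative f') (at x) \<longleftrightarrow> (g has_derivative f') (at x)" for f'
    using has_derivative_transform_within_open[of f f' x UNIV U g]
      has_derivative_transform_within_open[of g f' x UNIV U f] assms by auto
  then show ?thesis unfolding frechet_derivative_def by simp
qed

lemma differentiable_cong_on_open:
  assumes "open U" "x \<in> U" "\<And>y. y \<in> U \<Longrightarrow> f y = g y" "f differentiable (at x)"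
  shows "g differentiable (at x)"
  using assms has_derivative_transform_within_open[of f _ x UNIV U g] unfolding differentiable_def by blast

text \<open>Openness is essential here: the derivatives at a point of \<open>U\<close> see the values of the map on a full
  neighbourhood.\<close>

lemma Ck_on_cong:
  assumes "open U" "\<And>x. x \<in> U \<Longrightarrow> f x = g x" "Ck_on k U f"
  shows "Ck_on k U g"
  using assms(2,3)
proof (induction k arbitrary: f g)
  case 0
  then show ?case by (simp cong: continuous_on_cong)
next
  case (Suc k)
  have "Ck_on k U (\<lambda>x. frechet_derivative g (at x) v)" for v
    using Suc.IH[of "\<lambda>x. frechet_derivative f (at x) v" "\<lambda>x. frechet_derivative g (at x) v"]
      frechet_derivative_cong_on_open[OF assms(1) _ Suc.prems(1)] Suc.prems(2) by simp
  moreover have "g differentiable (at x)" if "x \<in> U" for x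
    using differentiable_cong_on_open[OF assms(1) that Suc.prems(1)] Suc.prems(2) that by simp
  ultimately show ?case by simp
qed

lemma Ck_on_SucD: "Ck_on (Suc k) U f \<Longrightarrow> Ck_on k U f"
proof (induction k arbitrary: f)
  case 0
  then show ?case
    by (auto intro!: continuous_at_imp_continuous_on differentiable_imp_continuous_within)
next
  case (Suc k)
  then show ?case by (metis Ck_on.simps(2))
qed

lemma Ck_on_bounded_linear:
  assumes "open U" "bounded_linear L" "Ck_on k U f"
  shows "Ck_on k U (\<lambda>x. L (f x))"
  using assms(3)
proof (induction k arbitrary: f)
  case 0
  then show ?case using assms(2) by (simp add: bounded_linear.continuous_on)
next
  case (Suc k)
  have D: "((\<lambda>x. L (f x)) has_derivative (\<lambda>v. L (frechet_derivative f (at x) v))) (at x)"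
    if "x \<in> U" for x
    using Suc.prems that
    by (intro bounded_linear.has_derivative[OF assms(2)] has_frechet_derivative) simp
  have "Ck_on k U (\<lambda>x. frechet_derivative (\<lambda>x. L (f x)) (at x) v)" for v
    by (rule Ck_on_cong[OF assms(1), of "\<lambda>x. L (frechet_derivative f (at x) v)"])
      (use Suc frechet_derivative_eq[OF D] in auto)
  then show ?case using D by (auto simp: differentiable_def)
qed

lemma Ck_on_add:
  assumes "open U" "Ck_on k U f" "Ck_on k U g"
  shows "Ck_on k U (\<lambda>x. f x + g x)"
  using assms(2,3)
proof (induction k arbitrary: f g)
  case 0
  then show ?case by (simp add: continuous_on_add)
next
  case (Suc k)
  have D: "((\<lambda>x. f x + g x) has_derivative
      (\<lambda>v. frechet_derivative f (at x) v + frechet_derivative g (at x) v)) (at x)"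
    if "x \<in> U" for x
    using Suc.prems that by (intro has_derivative_add has_frechet_derivative) auto
  have "Ck_on k U (\<lambda>x. frechet_derivative (\<lambda>x. f x + g x) (at x) v)" for v
    by (rule Ck_on_cong[OF assms(1), of
          "\<lambda>x. frechet_derivative f (at x) v + frechet_derivative g (at x) v"])
      (use Suc frechet_derivative_eq[OF D] in auto)
  then show ?case using D by (auto simp: differentiable_def)
qed

lemma Ck_on_bilinear:
  assumes "open U" "bounded_bilinear h" "Ck_on k U f" "Ck_on k U g"
  shows "Ck_on k U (\<lambda>x. h (f x) (g x))"
  using assms(3,4)
proof (induction k arbitrary: f g)
  case 0
  then show ?case by (simp add: bounded_bilinear.continuous_on[OF assms(2)])
next
  case (Suc k)
  have D: "((\<lambda>x. h (f x) (g x)) has_derivative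
      (\<lambda>v. h (f x) (frechet_derivative g (at x) v) + h (frechet_derivative f (at x) v) (g x))) (at x)"
    if "x \<in> U" for x
    using Suc.prems that
    by (intro bounded_bilinear.FDERIV[OF assms(2)] has_frechet_derivative) auto
  have "Ck_on k U (\<lambda>x. h (f x) (frechet_derivative g (at x) v)
      + h (frechet_derivative f (at x) v) (g x))" for v
    using Suc.prems Ck_on_SucD[OF Suc.prems(1)] Ck_on_SucD[OF Suc.prems(2)]
    by (intro Ck_on_add Suc.IH assms(1)) simp_all
  then have "Ck_on k U (\<lambda>x. frechet_derivative (\<lambda>x. h (f x) (g x)) (at x) v)" for v
    by (rule Ck_on_cong[OF assms(1), rotated]) (use frechet_derivative_eq[OF D] in auto)
  then show ?case using D by (auto simp: differentiable_def)
qed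

lemma smooth_on_differentiable: "smooth_on U f \<Longrightarrow> x \<in> U \<Longrightarrow> f differentiable (at x)"
  unfolding smooth_on_def by (metis Ck_on.simps(2))

lemma smooth_on_has_derivative:
  "smooth_on U f \<Longrightarrow> x \<in> U \<Longrightarrow> (f has_derivative frechet_derivative f (at x)) (at x)"
  by (intro has_frechet_derivative smooth_on_differentiable)

lemma smooth_on_continuous: "smooth_on U f \<Longrightarrow> continuous_on U f"
  unfolding smooth_on_def by (metis Ck_on.simps(1))

lemma smooth_on_frechet_derivative:
  "smooth_on U f \<Longrightarrow> smooth_on U (\<lambda>x. frechet_derivative f (at x) v)"
  unfolding smooth_on_def by (metis Ck_on.simps(2))

lemma smooth_on_cong:
  "open U \<Longrightarrow> (\<And>x. x \<in> U \<Longrightarrow> f x = g x) \<Longrightarrow> smooth_on U f \<Longrightarrow> smooth_on U g"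
  unfolding smooth_on_def using Ck_on_cong by blast

lemma smooth_on_bounded_linear:
  "open U \<Longrightarrow> bounded_linear L \<Longrightarrow> smooth_on U f \<Longrightarrow> smooth_on U (\<lambda>x. L (f x))"
  unfolding smooth_on_def using Ck_on_bounded_linear by blast

lemma smooth_on_add:
  "open U \<Longrightarrow> smooth_on U f \<Longrightarrow> smooth_on U g \<Longrightarrow> smooth_on U (\<lambda>x. f x + g x)"
  unfolding smooth_on_def using Ck_on_add by blast

lemma smooth_on_bilinear:
  "open U \<Longrightarrow> bounded_bilinear h \<Longrightarrow> smooth_on U f \<Longrightarrow> smooth_on U g
    \<Longrightarrow> smooth_on U (\<lambda>x. h (f x) (g x))"
  unfolding smooth_on_def using Ck_on_bilinear by blast

lemmas smooth_on_scaleR = smooth_on_bilinear[OF _ bounded_bilinear_scaleR]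
lemmas smooth_on_mult = smooth_on_bilinear[OF _ bounded_bilinear_mult]

lemma smooth_on_const: 
  assumes "open U" shows "smooth_on U (\<lambda>x. c)"
proof -
  have "Ck_on k U (\<lambda>x. 0 :: 'b)" for k
    by (induction k) auto
  then have "Ck_on k U (\<lambda>x. c)" for k
    by (cases k) auto
  then show ?thesis by (simp add: smooth_on_def)
qed

lemma smooth_on_sum:
  assumes "open U" "finite I" "\<And>i. i \<in> I \<Longrightarrow> smooth_on U (f i)"
  shows "smooth_on U (\<lambda>x. \<Sum>i\<in>I. f i x)"
  using assms(2,3) by (induction I) (auto intro: smooth_on_const smooth_on_add assms(1))


section \<open>Symmetry of second derivatives\<close>

text \<open>The second difference of \<open>f\<close> over the parallelogram spanned by \<open>t v\<close> and \<open>t w\<close> is, by two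
  applications of the mean value theorem, a value of the mixed derivative inside.\<close>

lemma second_difference_mean_value:
  fixes f :: "'a::real_normed_vector \<Rightarrow> real"
  assumes t: "t > 0"
    and U: "\<And>r s. \<lbrakk>0 \<le> r; r \<le> t; 0 \<le> s; s \<le> t\<rbrakk> \<Longrightarrow> x + r *\<^sub>R v + s *\<^sub>R w \<in> U"
    and f: "\<And>y. y \<in> U \<Longrightarrow> f differentiable (at y)"
    and f': "\<And>y. y \<in> U \<Longrightarrow> (\<lambda>y. frechet_derivative f (at y) v) differentiable (at y)"
  shows "\<exists>r s. 0 < r \<and> r < t \<and> 0 < s \<and> s < t \<and>
    f (x + t *\<^sub>R v + t *\<^sub>R w) - f (x + t *\<^sub>R v) - f (x + t *\<^sub>R w) + f x =
    t * t * frechet_derivative (\<lambda>y. frechet_derivative f (at y) v) (at (x + r *\<^sub>R v + s *\<^sub>R w)) w"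
proof -
  let ?p = "\<lambda>y. frechet_derivative f (at y) v"
  have line: "DERIV (\<lambda>r. g (a + r *\<^sub>R u)) r :> frechet_derivative g (at (a + r *\<^sub>R u)) u"
    if "g differentiable (at (a + r *\<^sub>R u))" for g :: "'a \<Rightarrow> real" and a u r
  proof -
    have "((\<lambda>r. a + r *\<^sub>R u) has_derivative (\<lambda>h. h *\<^sub>R u)) (at r)"
      by (auto intro!: derivative_eq_intros)
    from diff_chain_at[OF this has_frechet_derivative[OF that]]
    have "((\<lambda>r. g (a + r *\<^sub>R u)) has_derivative
        (\<lambda>h. frechet_derivative g (at (a + r *\<^sub>R u)) (h *\<^sub>R u))) (at r)"
      by (simp add: o_def)
    moreover have "frechet_derivative g (at (a + r *\<^sub>R u)) (h *\<^sub>R u)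
        = frechet_derivative g (at (a + r *\<^sub>R u)) u * h" for h
      using linear_cmul[OF linear_frechet_derivative[OF that]] by (simp add: mult.commute)
    ultimately show ?thesis by (simp add: has_field_derivative_def)
  qed
  have "DERIV (\<lambda>r. f ((x + t *\<^sub>R w) + r *\<^sub>R v) - f (x + r *\<^sub>R v)) r :>
      ?p ((x + t *\<^sub>R w) + r *\<^sub>R v) - ?p (x + r *\<^sub>R v)" if "0 \<le> r" "r \<le> t" for r
    using U[OF that, of t] U[OF that, of 0] t
    by (intro DERIV_diff line f) (simp_all add: algebra_simps)
  from MVT2[OF t this] obtain r where r: "0 < r" "r < t" and
    1: "(f ((x + t *\<^sub>R w) + t *\<^sub>R v) - f (x + t *\<^sub>R v)) - (f (x + t *\<^sub>R w) - f x) =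
        t * (?p ((x + t *\<^sub>R w) + r *\<^sub>R v) - ?p (x + r *\<^sub>R v))" by auto
  have "DERIV (\<lambda>s. ?p ((x + r *\<^sub>R v) + s *\<^sub>R w)) s :> frechet_derivative ?p (at ((x + r *\<^sub>R v) + s *\<^sub>R w)) w"
    if "0 \<le> s" "s \<le> t" for s
    using U[of r s] that r by (intro line f') auto
  from MVT2[OF t this] obtain s where s: "0 < s" "s < t" and
    2: "?p ((x + r *\<^sub>R v) + t *\<^sub>R w) - ?p (x + r *\<^sub>R v) =
        t * frechet_derivative ?p (at ((x + r *\<^sub>R v) + s *\<^sub>R w)) w" by auto
  have "f (x + t *\<^sub>R v + t *\<^sub>R w) - f (x + t *\<^sub>R v) - f (x + t *\<^sub>R w) + f x =
      t * (?p ((x + r *\<^sub>R v) + t *\<^sub>R w) - ?p (x + r *\<^sub>R v))"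
    using 1 by (simp add: algebra_simps)
  then show ?thesis using r s unfolding 2 by (metis mult.assoc)
qed

text \<open>The second difference is symmetric in \<open>v\<close> and \<open>w\<close>, so arbitrarily close to \<open>x\<close> each mixed
  derivative takes a value that the other one takes too; continuity transfers the equality to \<open>x\<close>.\<close>

lemma second_derivative_symmetric_real:
  fixes f :: "'a::real_normed_vector \<Rightarrow> real"
  assumes "open U" "smooth_on U f" "x \<in> U"
  shows "frechet_derivative (\<lambda>y. frechet_derivative f (at y) v) (at x) w =
         frechet_derivative (\<lambda>y. frechet_derivative f (at y) w) (at x) v"
proof (rule ccontr)
  define a where "a = (\<lambda>v w y. frechet_derivative (\<lambda>y. frechet_derivative f (at y) v) (at y) w)"
  assume "\<not> ?thesis"
  then have e: "\<bar>a v w x - a w v x\<bar> / 2 > 0" by (simp add: a_def)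
  have cont: "isCont (a v w) x" for v w
    using smooth_on_continuous[OF smooth_on_frechet_derivative[OF smooth_on_frechet_derivative[OF assms(2)]]]
      assms(1,3) unfolding a_def by (simp add: continuous_on_eq_continuous_at)
  obtain d1 where d1: "d1 > 0" "\<And>y. dist y x < d1 \<Longrightarrow> dist (a v w y) (a v w x) < \<bar>a v w x - a w v x\<bar> / 2"
    using cont[of v w] e unfolding continuous_at_eps_delta by metis
  obtain d2 where d2: "d2 > 0" "\<And>y. dist y x < d2 \<Longrightarrow> dist (a w v y) (a w v x) < \<bar>a v w x - a w v x\<bar> / 2"
    using cont[of w v] e unfolding continuous_at_eps_delta by metis
  obtain d3 where d3: "d3 > 0" "ball x d3 \<subseteq> U"
    using assms(1,3) openE by blast
  define d where "d = min d1 (min d2 d3)"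
  have d: "d > 0" "ball x d \<subseteq> U" using d1 d2 d3 by (auto simp: d_def)
  \<comment> \<open>a size of parallelogram that keeps it within distance \<open>d/2\<close> of \<open>x\<close>\<close>
  define t where "t = d / (2 * (norm v + norm w + 1))"
  have n: "norm v + norm w + 1 > 0" by (smt (verit) norm_ge_zero)
  have t: "t > 0" using d n by (simp add: t_def)
  have near: "dist (x + r *\<^sub>R v + s *\<^sub>R w) x < d" if "0 \<le> r" "r \<le> t" "0 \<le> s" "s \<le> t" for r s
  proof -
    have "dist (x + r *\<^sub>R v + s *\<^sub>R w) x = norm (r *\<^sub>R v + s *\<^sub>R w)"
      by (simp add: dist_norm algebra_simps)
    also have "\<dots> \<le> r * norm v + s * norm w"
      using norm_triangle_ineq[of "r *\<^sub>R v" "s *\<^sub>R w"] that by simp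
    also have "\<dots> \<le> t * norm v + t * norm w"
      using that by (intro add_mono mult_right_mono) auto
    also have "\<dots> \<le> t * (norm v + norm w + 1)" using t by (simp add: algebra_simps)
    also have "\<dots> = d / 2"
    proof -
      have "d / (2 * N) * N = d / 2" if "N > 0" for N :: real using that by simp
      then show ?thesis using n unfolding t_def by blast
    qed
    finally show ?thesis using d by simp
  qed
  have U: "x + r *\<^sub>R v + s *\<^sub>R w \<in> U" if "0 \<le> r" "r \<le> t" "0 \<le> s" "s \<le> t" for r s
    using near[OF that] d(2) by (auto simp: dist_commute)
  have f: "f differentiable (at y)" "(\<lambda>y. frechet_derivative f (at y) u) differentiable (at y)" if "y \<in> U" for y u
    using smooth_on_differentiable that smooth_on_frechet_derivative assms(2) by blast+
  obtain r s where rs: "0 < r" "r < t" "0 < s" "s < t"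
    "f (x + t *\<^sub>R v + t *\<^sub>R w) - f (x + t *\<^sub>R v) - f (x + t *\<^sub>R w) + f x = t * t * a v w (x + r *\<^sub>R v + s *\<^sub>R w)"
    using second_difference_mean_value[OF t, of x v w U f] U f unfolding a_def by blast
  have U': "x + s *\<^sub>R w + r *\<^sub>R v \<in> U" if "0 \<le> s" "s \<le> t" "0 \<le> r" "r \<le> t" for r s
    using U[OF that(3,4,1,2)] by (simp add: algebra_simps)
  obtain r' s' where rs': "0 < r'" "r' < t" "0 < s'" "s' < t"
    "f (x + t *\<^sub>R w + t *\<^sub>R v) - f (x + t *\<^sub>R w) - f (x + t *\<^sub>R v) + f x = t * t * a w v (x + s' *\<^sub>R w + r' *\<^sub>R v)"
    using second_difference_mean_value[OF t, of x w v U f] U' f unfolding a_def by blast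
  have "t * t * a v w (x + r *\<^sub>R v + s *\<^sub>R w) = t * t * a w v (x + r' *\<^sub>R v + s' *\<^sub>R w)"
    using rs(5) rs'(5) by (simp add: algebra_simps)
  then have eq: "a v w (x + r *\<^sub>R v + s *\<^sub>R w) = a w v (x + r' *\<^sub>R v + s' *\<^sub>R w)"
    using t by simp
  have "dist (a v w (x + r *\<^sub>R v + s *\<^sub>R w)) (a v w x) < \<bar>a v w x - a w v x\<bar> / 2"
    using near[of r s] rs by (intro d1) (auto simp: d_def)
  moreover have "dist (a w v (x + r' *\<^sub>R v + s' *\<^sub>R w)) (a w v x) < \<bar>a v w x - a w v x\<bar> / 2"
    using near[of r' s'] rs' by (intro d2) (auto simp: d_def)
  ultimately show False using eq unfolding dist_real_def by (smt (verit) field_sum_of_halves)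
qed

lemma second_derivative_symmetric:
  fixes f :: "'a::real_normed_vector \<Rightarrow> 'b::euclidean_space"
  assumes U: "open U" and f: "smooth_on U f" and x: "x \<in> U"
  shows "frechet_derivative (\<lambda>y. frechet_derivative f (at y) v) (at x) w =
         frechet_derivative (\<lambda>y. frechet_derivative f (at y) w) (at x) v"
proof (rule euclidean_eqI)
  fix b :: 'b
  have D: "frechet_derivative (\<lambda>y. g y \<bullet> b) (at y) u = frechet_derivative g (at y) u \<bullet> b"
    if "smooth_on U g" "y \<in> U" for g y u
    using frechet_derivative_eq[OF has_derivative_inner_left[OF smooth_on_has_derivative[OF that]]] by metis
  have D2: "frechet_derivative (\<lambda>y. frechet_derivative f (at y) v) (at x) w \<bullet> b =
      frechet_derivative (\<lambda>y. frechet_derivative (\<lambda>y. f y \<bullet> b) (at y) v) (at x) w" for v w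
    unfolding D[OF smooth_on_frechet_derivative[OF f] x, symmetric]
    by (rule fun_cong[OF frechet_derivative_cong_on_open[OF U x]]) (simp add: D f)
  show "frechet_derivative (\<lambda>y. frechet_derivative f (at y) v) (at x) w \<bullet> b =
      frechet_derivative (\<lambda>y. frechet_derivative f (at y) w) (at x) v \<bullet> b"
    unfolding D2
    by (rule second_derivative_symmetric_real[OF U _ x])
      (intro smooth_on_bounded_linear[OF U bounded_linear_inner_left] f)
qed


section \<open>Vector fields on an open set of a Euclidean space\<close>

definition derive_along :: "('a::real_normed_vector \<Rightarrow> 'a) \<Rightarrow> ('a \<Rightarrow> 'b::real_normed_vector) \<Rightarrow> 'a \<Rightarrow> 'b" where
  "derive_along X f z = frechet_derivative f (at z) (X z)"

definition bracket :: "('a::real_normed_vector \<Rightarrow> 'a) \<Rightarrow> ('a \<Rightarrow> 'a) \<Rightarrow> 'a \<Rightarrow> 'a" where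
  "bracket X Y z = derive_along X Y z - derive_along Y X z"

lemma frechet_derivative_expand:
  fixes f :: "'a::euclidean_space \<Rightarrow> 'b::real_normed_vector"
  assumes "f differentiable (at z)"
  shows "frechet_derivative f (at z) v = (\<Sum>b\<in>Basis. (v \<bullet> b) *\<^sub>R frechet_derivative f (at z) b)"
proof -
  have "frechet_derivative f (at z) (\<Sum>b\<in>Basis. (v \<bullet> b) *\<^sub>R b) = (\<Sum>b\<in>Basis. (v \<bullet> b) *\<^sub>R frechet_derivative f (at z) b)"
    using linear_frechet_derivative[OF assms] by (simp add: linear_sum linear_cmul)
  then show ?thesis by (simp add: euclidean_representation)
qed

lemma smooth_on_derive_along:
  fixes f :: "'a::euclidean_space \<Rightarrow> 'b::real_normed_vector"
  assumes U: "open U" and X: "smooth_on U X" and f: "smooth_on U f"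
  shows "smooth_on U (derive_along X f)"
proof (rule smooth_on_cong[OF U])
  show "smooth_on U (\<lambda>z. \<Sum>b\<in>Basis. (X z \<bullet> b) *\<^sub>R frechet_derivative f (at z) b)"
    by (intro smooth_on_sum smooth_on_scaleR smooth_on_frechet_derivative f U finite_Basis
        smooth_on_bounded_linear[OF U bounded_linear_inner_left] X)
qed (use frechet_derivative_expand[OF smooth_on_differentiable[OF f]] in \<open>simp add: derive_along_def\<close>)

text \<open>The product rule for \<open>z \<mapsto> Df(z)(X z)\<close>. The vector \<open>X z\<close> is expanded in the standard
  basis, which reduces it to finitely many products of functions.\<close>

lemma frechet_derivative_derive_along:
  fixes f :: "'a::euclidean_space \<Rightarrow> 'b::real_normed_vector"
  assumes U: "open U" and X: "smooth_on U X" and f: "smooth_on U f" and z: "z \<in> U"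
  shows "frechet_derivative (derive_along X f) (at z) w =
    frechet_derivative (\<lambda>y. frechet_derivative f (at y) (X z)) (at z) w
    + frechet_derivative f (at z) (frechet_derivative X (at z) w)"
proof -
  let ?f = "\<lambda>b y. frechet_derivative f (at y) b"
  have fd: "f differentiable (at y)" if "y \<in> U" for y
    using smooth_on_differentiable[OF f that] .
  have fb: "(?f b has_derivative frechet_derivative (?f b) (at z)) (at z)" for b
    using smooth_on_has_derivative[OF smooth_on_frechet_derivative[OF f] z] .
  have expand: "((\<lambda>y. \<Sum>b\<in>Basis. (X y \<bullet> b) *\<^sub>R ?f b y) has_derivative
     (\<lambda>w. \<Sum>b\<in>Basis. (X z \<bullet> b) *\<^sub>R frechet_derivative (?f b) (at z) w
          + (frechet_derivative X (at z) w \<bullet> b) *\<^sub>R ?f b z)) (at z)"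
    by (intro has_derivative_sum has_derivative_scaleR has_derivative_inner_left fb
        smooth_on_has_derivative[OF X z])
  have const: "((\<lambda>y. \<Sum>b\<in>Basis. (X z \<bullet> b) *\<^sub>R ?f b y) has_derivative
     (\<lambda>w. \<Sum>b\<in>Basis. (X z \<bullet> b) *\<^sub>R frechet_derivative (?f b) (at z) w)) (at z)"
    by (intro has_derivative_sum has_derivative_scaleR_right fb)
  have "frechet_derivative (derive_along X f) (at z) =
      frechet_derivative (\<lambda>y. \<Sum>b\<in>Basis. (X y \<bullet> b) *\<^sub>R ?f b y) (at z)"
    by (rule frechet_derivative_cong_on_open[OF U z])
      (use frechet_derivative_expand[OF fd] in \<open>simp add: derive_along_def\<close>)
  moreover have "frechet_derivative (?f (X z)) (at z) =
      frechet_derivative (\<lambda>y. \<Sum>b\<in>Basis. (X z \<bullet> b) *\<^sub>R ?f b y) (at z)"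
    by (rule frechet_derivative_cong_on_open[OF U z])
      (use frechet_derivative_expand[OF fd] in simp)
  ultimately show ?thesis
    unfolding frechet_derivative_eq[OF expand] frechet_derivative_eq[OF const]
    by (subst frechet_derivative_expand[OF fd[OF z], of "frechet_derivative X (at z) w"])
      (simp add: sum.distrib)
qed

text \<open>The second-order terms cancel by symmetry; the first-order terms make up the bracket.\<close>

lemma derive_along_commutator:
  fixes f :: "'a::euclidean_space \<Rightarrow> 'b::euclidean_space"
  assumes U: "open U" and X: "smooth_on U X" and Y: "smooth_on U Y" and f: "smooth_on U f" and z: "z \<in> U"
  shows "derive_along X (derive_along Y f) z - derive_along Y (derive_along X f) z
    = derive_along (bracket X Y) f z"
proof -
  have "linear (frechet_derivative f (at z))"
    using linear_frechet_derivative smooth_on_differentiable[OF f z] .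
  then show ?thesis
    unfolding derive_along_def[of _ "derive_along _ _"]
      frechet_derivative_derive_along[OF U X f z] frechet_derivative_derive_along[OF U Y f z]
    using second_derivative_symmetric[OF U f z, of "X z" "Y z"]
    by (simp add: derive_along_def bracket_def linear_diff)
qed

lemma derive_along_cong:
  assumes "open U" "z \<in> U" "\<And>y. y \<in> U \<Longrightarrow> f y = g y"
  shows "derive_along X f z = derive_along X g z"
  unfolding derive_along_def using frechet_derivative_cong_on_open[OF assms] by simp

lemma derive_along_add:
  assumes "smooth_on U f" "smooth_on U g" "z \<in> U"
  shows "derive_along X (\<lambda>y. f y + g y) z = derive_along X f z + derive_along X g z"
  unfolding derive_along_def
  by (subst frechet_derivative_eq[OF has_derivative_add[OF smooth_on_has_derivative smooth_on_has_derivative]])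
    (use assms in auto)

lemma derive_along_diff:
  assumes "smooth_on U f" "smooth_on U g" "z \<in> U"
  shows "derive_along X (\<lambda>y. f y - g y) z = derive_along X f z - derive_along X g z"
  unfolding derive_along_def
  by (subst frechet_derivative_eq[OF has_derivative_diff[OF smooth_on_has_derivative smooth_on_has_derivative]])
    (use assms in auto)

lemma derive_along_scaleR:
  assumes "smooth_on U f" "smooth_on U g" "z \<in> U"
  shows "derive_along X (\<lambda>y. f y *\<^sub>R g y) z = f z *\<^sub>R derive_along X g z + derive_along X f z *\<^sub>R g z"
  unfolding derive_along_def
  by (subst frechet_derivative_eq[OF has_derivative_scaleR[OF smooth_on_has_derivative smooth_on_has_derivative]])
    (use assms in auto)

lemma bracket_cong:
  assumes "open U" "z \<in> U" "\<And>y. y \<in> U \<Longrightarrow> Y y = Y' y"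
  shows "bracket X Y z = bracket X Y' z"
  using assms derive_along_cong[OF assms] by (simp add: bracket_def derive_along_def)

lemma bracket_swap: "bracket X Y z = - bracket Y X z"
  by (simp add: bracket_def)

lemma bracket_self: "bracket X X z = 0"
  by (simp add: bracket_def)

lemma bracket_add:
  assumes "smooth_on U X" "smooth_on U Y" "smooth_on U Z" "z \<in> U"
  shows "bracket X (\<lambda>y. Y y + Z y) z = bracket X Y z + bracket X Z z"
  using derive_along_add[OF assms(2-4)] linear_frechet_derivative[OF smooth_on_differentiable[OF assms(1,4)]]
  by (simp add: bracket_def derive_along_def linear_add)

lemma bracket_scaleR:
  assumes "smooth_on U X" "smooth_on U f" "smooth_on U Y" "z \<in> U"
  shows "bracket X (\<lambda>y. f y *\<^sub>R Y y) z = f z *\<^sub>R bracket X Y z + derive_along X f z *\<^sub>R Y z"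
  using derive_along_scaleR[OF assms(2-4)] linear_frechet_derivative[OF smooth_on_differentiable[OF assms(1,4)]]
  by (simp add: bracket_def derive_along_def linear_cmul scaleR_diff_right)

text \<open>A bracket is a difference of derivatives of vector-valued maps. The commutator rule for the maps
  \<open>X\<close>, \<open>Y\<close> and \<open>Z\<close> themselves writes each double bracket through iterated derivatives, and these
  cancel in the cyclic sum.\<close>

lemma bracket_Jacobi:
  fixes X Y Z :: "'a::euclidean_space \<Rightarrow> 'a"
  assumes U: "open U" and X: "smooth_on U X" and Y: "smooth_on U Y" and Z: "smooth_on U Z" and z: "z \<in> U"
  shows "bracket X (bracket Y Z) z + bracket Y (bracket Z X) z + bracket Z (bracket X Y) z = 0"
proof -
  have expand: "bracket P (bracket Q R) z =
      derive_along P (derive_along Q R) z - derive_along P (derive_along R Q) z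
      - (derive_along Q (derive_along R P) z - derive_along R (derive_along Q P) z)"
    if P: "smooth_on U P" and Q: "smooth_on U Q" and R: "smooth_on U R" for P Q R
  proof -
    have "derive_along P (bracket Q R) z =
        derive_along P (derive_along Q R) z - derive_along P (derive_along R Q) z"
      unfolding bracket_def[abs_def]
      by (rule derive_along_diff[OF smooth_on_derive_along[OF U Q R] smooth_on_derive_along[OF U R Q] z])
    then show ?thesis
      unfolding derive_along_commutator[OF U Q R P z] by (simp add: bracket_def)
  qed
  show ?thesis
    unfolding expand[OF X Y Z] expand[OF Y Z X] expand[OF Z X Y] by simp
qed


section \<open>Structure equations in one chart\<close>

text \<open>The left-hand side is the cyclic sum in the Jacobi identity for \<open>S\<close>, \<open>H\<close> and \<open>V\<close>: its \<open>S\<close>- and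
  \<open>H\<close>-parts cancel, the latter because \<open>J\<close> is the derivative of \<open>I\<close> along \<open>S\<close>.\<close>

lemma structure_equations_Jacobi:
  fixes S H V :: "'a::euclidean_space \<Rightarrow> 'a" and I J \<rho> :: "'a \<Rightarrow> real"
  assumes U: "open U"
    and S: "smooth_on U S" and H: "smooth_on U H" and V: "smooth_on U V"
    and I: "smooth_on U I" and r: "smooth_on U \<rho>"
    and J: "\<And>z. z \<in> U \<Longrightarrow> J z = derive_along S I z"
    and SH: "\<And>z. z \<in> U \<Longrightarrow> bracket S H z = \<rho> z *\<^sub>R V z"
    and VS: "\<And>z. z \<in> U \<Longrightarrow> bracket V S z = H z"
    and HV: "\<And>z. z \<in> U \<Longrightarrow> bracket H V z = S z + I z *\<^sub>R H z + J z *\<^sub>R V z"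
    and Vr: "derive_along V \<rho> z = 0" and z: "z \<in> U"
  shows "(I z * \<rho> z + derive_along S J z) *\<^sub>R V z = 0"
proof -
  have Js: "smooth_on U J"
    using smooth_on_cong[OF U _ smooth_on_derive_along[OF U S I]] J by simp
  have IH: "smooth_on U (\<lambda>z. I z *\<^sub>R H z)" and JV: "smooth_on U (\<lambda>z. J z *\<^sub>R V z)"
    by (intro smooth_on_scaleR U I H V Js)+
  have "bracket S (bracket H V) z = bracket S (\<lambda>z. S z + I z *\<^sub>R H z + J z *\<^sub>R V z) z"
    by (rule bracket_cong[OF U z HV])
  also have "\<dots> = I z *\<^sub>R bracket S H z + derive_along S I z *\<^sub>R H z
      + (J z *\<^sub>R bracket S V z + derive_along S J z *\<^sub>R V z)"
    by (simp add: bracket_add[OF S smooth_on_add[OF U S IH] JV z] bracket_add[OF S S IH z]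
        bracket_scaleR[OF S I H z] bracket_scaleR[OF S Js V z] bracket_self)
  also have "\<dots> = (I z * \<rho> z + derive_along S J z) *\<^sub>R V z"
    unfolding bracket_swap[of S V] SH[OF z] VS[OF z] J[OF z, symmetric] by (simp add: algebra_simps)
  finally have 1: "bracket S (bracket H V) z = (I z * \<rho> z + derive_along S J z) *\<^sub>R V z" .
  have 2: "bracket H (bracket V S) z = 0"
    using bracket_cong[OF U z VS] by (simp add: bracket_self)
  have "bracket V (bracket S H) z = bracket V (\<lambda>z. \<rho> z *\<^sub>R V z) z"
    by (rule bracket_cong[OF U z SH])
  then have 3: "bracket V (bracket S H) z = 0"
    using bracket_scaleR[OF V r V z] by (simp add: bracket_self Vr)
  show ?thesis
    using bracket_Jacobi[OF U S H V z] unfolding 1 2 3 by simp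
qed

text \<open>The terms \<open>H(J)\<close> and \<open>\<rho> V(I)\<close>, which arise when \<open>S\<close> is moved past \<open>H\<close> and \<open>V\<close>, appear once
  with each sign.\<close>

lemma structure_equations_first_integral:
  fixes S H V :: "'a::euclidean_space \<Rightarrow> 'a" and I J \<rho> :: "'a \<Rightarrow> real"
  assumes U: "open U"
    and S: "smooth_on U S" and H: "smooth_on U H" and V: "smooth_on U V"
    and I: "smooth_on U I" and r: "smooth_on U \<rho>"
    and J: "\<And>z. z \<in> U \<Longrightarrow> J z = derive_along S I z"
    and SH: "\<And>z. z \<in> U \<Longrightarrow> bracket S H z = \<rho> z *\<^sub>R V z"
    and VS: "\<And>z. z \<in> U \<Longrightarrow> bracket V S z = H z"
    and SJ: "\<And>z. z \<in> U \<Longrightarrow> derive_along S J z = - I z * \<rho> z"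
    and Vr: "derive_along V \<rho> z = 0" and z: "z \<in> U"
  shows "derive_along S (\<lambda>y. derive_along H I y + derive_along V J y) z = 0"
proof -
  have Js: "smooth_on U J"
    using smooth_on_cong[OF U _ smooth_on_derive_along[OF U S I]] J by simp
  have DI: "linear (frechet_derivative I (at z))" and DJ: "linear (frechet_derivative J (at z))"
    using linear_frechet_derivative smooth_on_differentiable I Js z by blast+
  have HJ: "derive_along H (derive_along S I) z = derive_along H J z"
    using derive_along_cong[OF U z, of "derive_along S I" J H] J by simp
  have "derive_along S (derive_along H I) z =
      derive_along H (derive_along S I) z + derive_along (bracket S H) I z"
    using derive_along_commutator[OF U S H I z] by (simp add: algebra_simps)
  also have "\<dots> = derive_along H J z + \<rho> z * derive_along V I z"
    unfolding HJ derive_along_def[of "bracket S H"] SH[OF z]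
    using linear_cmul[OF DI] by (simp add: derive_along_def)
  finally have 1: "derive_along S (derive_along H I) z = derive_along H J z + \<rho> z * derive_along V I z" .
  have "derive_along S (derive_along V J) z =
      derive_along V (derive_along S J) z + derive_along (bracket S V) J z"
    using derive_along_commutator[OF U S V Js z] by (simp add: algebra_simps)
  also have "derive_along (bracket S V) J z = - derive_along H J z"
    using bracket_swap[of S V z] VS[OF z] linear_neg[OF DJ] by (simp add: derive_along_def)
  also have "derive_along V (derive_along S J) z = derive_along V (\<lambda>z. (- I z) *\<^sub>R \<rho> z) z"
    using SJ by (intro derive_along_cong[OF U z]) simp
  also have "\<dots> = derive_along V (\<lambda>z. - I z) z * \<rho> z"
    using derive_along_scaleR[of U "\<lambda>z. - I z" \<rho> z V] r z Vr
      smooth_on_bounded_linear[OF U bounded_linear_minus[OF bounded_linear_ident] I] by simp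
  also have "derive_along V (\<lambda>z. - I z) z = - derive_along V I z"
    using frechet_derivative_eq[OF has_derivative_minus[OF smooth_on_has_derivative[OF I z]]]
    by (simp add: derive_along_def)
  finally have 2: "derive_along S (derive_along V J) z = - (\<rho> z * derive_along V I z) - derive_along H J z"
    by simp
  show ?thesis
    using derive_along_add[OF smooth_on_derive_along[OF U H I] smooth_on_derive_along[OF U V Js] z, of S] 1 2
    by simp
qed



section \<open>Charts, tangent vectors and differentials\<close>

text \<open>The part of the notion of an atlas that concerns only the charts and not the topology: it is all
  that the chain rule for changes of chart needs, and it can be checked for the induced charts on the
  slit tangent bundle without choosing a topology there.\<close>

definition compatible_atlas :: "('a, 'e::euclidean_space) chart set \<Rightarrow> bool" where
  "compatible_atlas A \<longleftrightarrow>
     (\<forall>c\<in>A. inj_on (snd c) (fst c)) \<and>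
     (\<forall>c\<in>A. \<forall>d\<in>A. open (snd c ` (fst c \<inter> fst d)) \<and>
        (\<forall>z\<in>snd c ` (fst c \<inter> fst d). (snd d \<circ> chart_inv c) differentiable (at z)))"

lemma chart_inv_apply:
  assumes "compatible_atlas A" "c \<in> A" "p \<in> fst c"
  shows "chart_inv c (snd c p) = p"
  using assms unfolding compatible_atlas_def chart_inv_def by simp

lemma chart_inv_mem: "z \<in> snd c ` fst c \<Longrightarrow> chart_inv c z \<in> fst c"
  unfolding chart_inv_def by (rule inv_into_into)

lemma chart_apply_inv: "z \<in> snd c ` fst c \<Longrightarrow> snd c (chart_inv c z) = z"
  unfolding chart_inv_def by (rule f_inv_into_f)

lemma compatible_atlas_open: "compatible_atlas A \<Longrightarrow> c \<in> A \<Longrightarrow> open (snd c ` fst c)"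
  unfolding compatible_atlas_def by (metis Int_absorb)

lemma compatible_atlas_open_Int:
  "compatible_atlas A \<Longrightarrow> c \<in> A \<Longrightarrow> d \<in> A \<Longrightarrow> open (snd c ` (fst c \<inter> fst d))"
  unfolding compatible_atlas_def by blast

lemma transition_differentiable:
  "\<lbrakk>compatible_atlas A; c \<in> A; d \<in> A; p \<in> fst c; p \<in> fst d\<rbrakk>
    \<Longrightarrow> (snd d \<circ> chart_inv c) differentiable (at (snd c p))"
  unfolding compatible_atlas_def by blast

text \<open>The chain rule for a change of chart. With \<open>g\<close> a real function it compares differentials in two
  charts; with \<open>g\<close> a third chart map it is the cocycle condition for transition derivatives.\<close>

lemma frechet_derivative_change_chart:
  fixes A :: "('a, 'e::euclidean_space) chart set" and g :: "'a \<Rightarrow> 'b::real_normed_vector"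
  assumes A: "compatible_atlas A" and c: "c \<in> A" "p \<in> fst c" and d: "d \<in> A" "p \<in> fst d"
    and g: "(g \<circ> chart_inv d) differentiable (at (snd d p))"
  shows "frechet_derivative (g \<circ> chart_inv c) (at (snd c p)) v =
    frechet_derivative (g \<circ> chart_inv d) (at (snd d p))
      (frechet_derivative (snd d \<circ> chart_inv c) (at (snd c p)) v)"
proof -
  let ?W = "snd c ` (fst c \<inter> fst d)"
  have eq: "((g \<circ> chart_inv d) \<circ> (snd d \<circ> chart_inv c)) z = (g \<circ> chart_inv c) z" if "z \<in> ?W" for z
    using that chart_inv_apply[OF A c(1)] chart_inv_apply[OF A d(1)] by auto
  have p: "(snd d \<circ> chart_inv c) (snd c p) = snd d p"
    using chart_inv_apply[OF A c] by simp
  have "((g \<circ> chart_inv d) has_derivative frechet_derivative (g \<circ> chart_inv d) (at (snd d p)))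
      (at ((snd d \<circ> chart_inv c) (snd c p)))"
    unfolding p by (rule has_frechet_derivative[OF g])
  from diff_chain_at[OF has_frechet_derivative[OF transition_differentiable[OF A c(1) d(1) c(2) d(2)]] this]
  have "(((g \<circ> chart_inv d) \<circ> (snd d \<circ> chart_inv c)) has_derivative
      (frechet_derivative (g \<circ> chart_inv d) (at (snd d p)) \<circ>
       frechet_derivative (snd d \<circ> chart_inv c) (at (snd c p)))) (at (snd c p))" .
  from has_derivative_transform_within_open[OF this compatible_atlas_open_Int[OF A c(1) d(1)] _ eq]
  have "((g \<circ> chart_inv c) has_derivative
      (frechet_derivative (g \<circ> chart_inv d) (at (snd d p)) \<circ>
       frechet_derivative (snd d \<circ> chart_inv c) (at (snd c p)))) (at (snd c p))"
    using c d by blast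
  from frechet_derivative_eq[OF this] show ?thesis by simp
qed

lemma tangent_space_transition:
  assumes "v \<in> tangent_space A p" "c \<in> A" "d \<in> A" "p \<in> fst c" "p \<in> fst d"
  shows "v d = frechet_derivative (snd d \<circ> chart_inv c) (at (snd c p)) (v c)"
  using assms unfolding tangent_space_def by blast

lemma tangent_space_outside:
  assumes "v \<in> tangent_space A p" "c \<notin> A \<or> p \<notin> fst c"
  shows "v c = 0"
  using assms unfolding tangent_space_def by blast

lemma tangent_vector_eqI:
  assumes "v \<in> tangent_space A p" "w \<in> tangent_space A p" "c \<in> A" "p \<in> fst c" "v c = w c"
  shows "v = w"
proof
  fix d
  show "v d = w d"
    using tangent_space_transition[OF assms(1,3) _ assms(4), of d] tangent_space_outside[OF assms(1), of d]
      tangent_space_transition[OF assms(2,3) _ assms(4), of d] tangent_space_outside[OF assms(2), of d] assms(5)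
    by (cases "d \<in> A \<and> p \<in> fst d") auto
qed

text \<open>The components in the other charts are forced by the transition rule, and the chain rule makes
  them consistent. This is what makes the images of the induced charts open.\<close>

lemma tangent_vector_exists:
  assumes A: "compatible_atlas A" and c: "c \<in> A" "p \<in> fst c"
  shows "\<exists>v\<in>tangent_space A p. v c = y"
proof -
  define v where "v = (\<lambda>d. if d \<in> A \<and> p \<in> fst d
    then frechet_derivative (snd d \<circ> chart_inv c) (at (snd c p)) y else 0)"
  \<comment> \<open>the cocycle condition: the chain rule with \<open>g\<close> the chart map of \<open>e\<close>\<close>
  have "v e = frechet_derivative (snd e \<circ> chart_inv d) (at (snd d p)) (v d)"
    if "d \<in> A" "e \<in> A" "p \<in> fst d" "p \<in> fst e" for d e
    using frechet_derivative_change_chart[OF A c that(1,3)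
        transition_differentiable[OF A that(1,2,3,4)]] that by (simp add: v_def)
  moreover have "v d = 0" if "d \<notin> A \<or> p \<notin> fst d" for d
    using that by (auto simp: v_def)
  ultimately have "v \<in> tangent_space A p"
    unfolding tangent_space_def by blast
  moreover have "v c = y"
  proof -
    have "frechet_derivative (snd c \<circ> chart_inv c) (at (snd c p)) = frechet_derivative (\<lambda>z. z) (at (snd c p))"
      using c chart_inv_apply[OF A c(1)]
      by (intro frechet_derivative_cong_on_open[OF compatible_atlas_open[OF A c(1)]]) auto
    then show ?thesis using c by (simp add: v_def)
  qed
  ultimately show ?thesis by blast
qed

text \<open>Together with \<open>tangent_vector_eqI\<close>: a tangent vector whose component vanishes in one chart is zero.\<close>

lemma tangent_vector_zero:
  assumes "compatible_atlas A"
  shows "(\<lambda>_. 0) \<in> tangent_space A p"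
proof -
  have "frechet_derivative (snd d \<circ> chart_inv c) (at (snd c p)) 0 = 0"
    if "c \<in> A" "d \<in> A" "p \<in> fst c" "p \<in> fst d" for c d
    by (rule linear_0[OF linear_frechet_derivative[OF transition_differentiable[OF assms that]]])
  then show ?thesis unfolding tangent_space_def by simp
qed

text \<open>\<^const>\<open>differential\<close> selects a chart separately at each point. A directional derivative can be
  differentiated again only after all points of a neighbourhood are moved to one common chart.\<close>

lemma differential_in_chart:
  assumes A: "compatible_atlas A" and c: "c \<in> A" "p \<in> fst c"
    and v: "v \<in> tangent_space A p" and f: "smooth_fun A f"
  shows "differential A f p v = frechet_derivative (f \<circ> chart_inv c) (at (snd c p)) (v c)"
proof -
  define d where "d = (SOME d. d \<in> A \<and> p \<in> fst d)"
  have d: "d \<in> A" "p \<in> fst d" using someI[of "\<lambda>d. d \<in> A \<and> p \<in> fst d" c] c by (auto simp: d_def)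
  have "(f \<circ> chart_inv c) differentiable (at (snd c p))"
    using f c smooth_on_differentiable unfolding smooth_fun_def by blast
  then show ?thesis
    unfolding differential_def Let_def d_def[symmetric]
      tangent_space_transition[OF v d(1) c(1) d(2) c(2)]
    by (rule frechet_derivative_change_chart[OF A d c])
qed

lemma vector_field_tangent:
  "vector_field A X \<Longrightarrow> c \<in> A \<Longrightarrow> p \<in> fst c \<Longrightarrow> X p \<in> tangent_space A p"
  unfolding vector_field_def charted_space_def by blast

lemma vector_field_smooth: "vector_field A X \<Longrightarrow> c \<in> A \<Longrightarrow> smooth_on (snd c ` fst c) (field_rep X c)"
  unfolding vector_field_def by blast

lemma smooth_fun_smooth: "smooth_fun A f \<Longrightarrow> c \<in> A \<Longrightarrow> smooth_on (snd c ` fst c) (f \<circ> chart_inv c)"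
  unfolding smooth_fun_def by blast

lemma smooth_fun_cong:
  assumes A: "compatible_atlas A" and f: "smooth_fun A f"
    and eq: "\<And>p. p \<in> charted_space A \<Longrightarrow> f p = g p"
  shows "smooth_fun A g"
  unfolding smooth_fun_def
proof
  fix c assume c: "c \<in> A"
  have "chart_inv c z \<in> charted_space A" if "z \<in> snd c ` fst c" for z
    using chart_inv_mem[OF that] c unfolding charted_space_def by blast
  then have "(f \<circ> chart_inv c) z = (g \<circ> chart_inv c) z" if "z \<in> snd c ` fst c" for z
    using eq that by simp
  from smooth_on_cong[OF compatible_atlas_open[OF A c] this smooth_fun_smooth[OF f c]]
  show "smooth_on (snd c ` fst c) (g \<circ> chart_inv c)" .
qed

lemma field_deriv_in_chart:
  assumes A: "compatible_atlas A" and X: "vector_field A X" and f: "smooth_fun A f"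
    and c: "c \<in> A" and z: "z \<in> snd c ` fst c"
  shows "field_deriv A X f (chart_inv c z) = derive_along (field_rep X c) (f \<circ> chart_inv c) z"
  unfolding field_deriv_def derive_along_def field_rep_def
  using differential_in_chart[OF A c chart_inv_mem[OF z] vector_field_tangent[OF X c chart_inv_mem[OF z]] f]
  by (simp add: chart_apply_inv[OF z])

lemma smooth_fun_field_deriv:
  assumes A: "compatible_atlas A" and X: "vector_field A X" and f: "smooth_fun A f"
  shows "smooth_fun A (field_deriv A X f)"
  unfolding smooth_fun_def
proof
  fix c assume c: "c \<in> A"
  show "smooth_on (snd c ` fst c) (field_deriv A X f \<circ> chart_inv c)"
    by (rule smooth_on_cong[OF compatible_atlas_open[OF A c]
          _ smooth_on_derive_along[OF compatible_atlas_open[OF A c] vector_field_smooth[OF X c] smooth_fun_smooth[OF f c]]])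
      (simp add: field_deriv_in_chart[OF A X f c])
qed

lemma smooth_fun_add:
  assumes A: "compatible_atlas A" and "smooth_fun A f" "smooth_fun A g"
  shows "smooth_fun A (\<lambda>p. f p + g p)"
  using assms smooth_on_add[OF compatible_atlas_open[OF A]] unfolding smooth_fun_def o_def by blast

lemma smooth_fun_mult:
  assumes A: "compatible_atlas A" and "smooth_fun A f" "smooth_fun A g"
  shows "smooth_fun A (\<lambda>p. f p * g p)"
  using assms smooth_on_mult[OF compatible_atlas_open[OF A]] unfolding smooth_fun_def o_def by blast

lemma lie_bracket_in_chart:
  assumes c: "c \<in> A" and z: "z \<in> snd c ` fst c"
  shows "lie_bracket A X Y (chart_inv c z) c = bracket (field_rep X c) (field_rep Y c) z"
  using c chart_inv_mem[OF z] chart_apply_inv[OF z]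
  by (simp add: lie_bracket_def bracket_def derive_along_def field_rep_def)

lemma smooth_manifold_compatible_atlas:
  assumes "smooth_manifold M A"
  shows "compatible_atlas A"
  unfolding compatible_atlas_def
proof (intro conjI ballI)
  fix c assume c: "c \<in> A"
  have o: "openin M (fst c)" "open (snd c ` fst c)"
    and h: "homeomorphic_map (subtopology M (fst c)) (top_of_set (snd c ` fst c)) (snd c)"
    using assms c unfolding smooth_manifold_def by auto
  have sub: "fst c \<subseteq> topspace M" using o openin_subset by blast
  show "inj_on (snd c) (fst c)"
    using homeomorphic_imp_injective_map[OF h] sub by (simp add: inf_absorb2)
  fix d assume d: "d \<in> A"
  have "openin M (fst d)" using assms d unfolding smooth_manifold_def by auto
  then have "openin (subtopology M (fst c)) (fst c \<inter> fst d)"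
    by (metis openin_subtopology_Int2)
  then have "openin (top_of_set (snd c ` fst c)) (snd c ` (fst c \<inter> fst d))"
    using homeomorphic_map_openness[OF h] sub by (metis openin_subset)
  then show "open (snd c ` (fst c \<inter> fst d))"
    using o(2) by (metis openin_open_trans)
  fix z assume "z \<in> snd c ` (fst c \<inter> fst d)"
  moreover have "smooth_on (snd c ` (fst c \<inter> fst d)) (snd d \<circ> chart_inv c)"
    using assms c d unfolding smooth_manifold_def by blast
  ultimately show "(snd d \<circ> chart_inv c) differentiable (at z)"
    using smooth_on_differentiable by blast
qed


section \<open>The slit tangent bundle\<close>

lemma induced_chart_mem:
  "(p, v) \<in> fst (induced_chart A c) \<longleftrightarrow>
    p \<in> charted_space A \<and> v \<in> tangent_space A p \<and> p \<in> fst c \<and> v \<noteq> (\<lambda>_. 0)"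
  unfolding induced_chart_def tangent_bundle_def by auto

lemma induced_chart_apply: "snd (induced_chart A c) (p, v) = (snd c p, v c)"
  unfolding induced_chart_def by simp

text \<open>Existence and uniqueness of a tangent vector with a given component: every \<open>y \<noteq> 0\<close> occurs, and
  \<open>y = 0\<close> only for the zero vector. For \<open>c = d\<close> this is the image of an induced chart.\<close>

lemma induced_chart_image:
  assumes A: "compatible_atlas A" and c: "c \<in> A" and d: "d \<in> A"
  shows "snd (induced_chart A c) ` (fst (induced_chart A c) \<inter> fst (induced_chart A d))
    = snd c ` (fst c \<inter> fst d) \<times> (- {0})"
proof (intro set_eqI iffI)
  fix z assume "z \<in> snd (induced_chart A c) ` (fst (induced_chart A c) \<inter> fst (induced_chart A d))"
  then obtain p v where pv: "(p, v) \<in> fst (induced_chart A c)" "(p, v) \<in> fst (induced_chart A d)"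
    and z: "z = snd (induced_chart A c) (p, v)" by auto
  have "v c \<noteq> 0"
    using tangent_vector_eqI[OF _ tangent_vector_zero[OF A] c] pv unfolding induced_chart_mem by blast
  then show "z \<in> snd c ` (fst c \<inter> fst d) \<times> (- {0})"
    using pv unfolding z induced_chart_mem induced_chart_apply by auto
next
  fix z :: coords assume "z \<in> snd c ` (fst c \<inter> fst d) \<times> (- {0})"
  then obtain p y where p: "p \<in> fst c" "p \<in> fst d" and y: "y \<noteq> 0" and z: "z = (snd c p, y)"
    by auto
  obtain v where v: "v \<in> tangent_space A p" "v c = y"
    using tangent_vector_exists[OF A c p(1)] by blast
  then have "v \<noteq> (\<lambda>_. 0)" using y by auto
  then have "(p, v) \<in> fst (induced_chart A c) \<inter> fst (induced_chart A d)"
    using p c v by (auto simp: induced_chart_mem charted_space_def)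
  then show "z \<in> snd (induced_chart A c) ` (fst (induced_chart A c) \<inter> fst (induced_chart A d))"
    unfolding z using induced_chart_apply[of A c p v] v(2) by (metis imageI)
qed

lemma induced_chart_inj:
  assumes A: "compatible_atlas A" and c: "c \<in> A"
  shows "inj_on (snd (induced_chart A c)) (fst (induced_chart A c))"
proof (rule inj_onI)
  fix a b assume a: "a \<in> fst (induced_chart A c)" and b: "b \<in> fst (induced_chart A c)"
    and eq: "snd (induced_chart A c) a = snd (induced_chart A c) b"
  obtain p v q w where ab: "a = (p, v)" "b = (q, w)" by fastforce
  have "p = q"
    using a b eq A c unfolding ab induced_chart_mem induced_chart_apply compatible_atlas_def
    by (auto dest: inj_onD)
  then show "a = b"
    using a b eq tangent_vector_eqI[OF _ _ c] unfolding ab induced_chart_mem induced_chart_apply by auto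
qed

text \<open>The fibre component is the transition rule by which tangent vectors are defined.\<close>

lemma induced_transition:
  assumes A: "compatible_atlas A" and c: "c \<in> A" and d: "d \<in> A"
    and z: "z \<in> snd c ` (fst c \<inter> fst d) \<times> (- {0})"
  shows "(snd (induced_chart A d) \<circ> chart_inv (induced_chart A c)) z =
    ((snd d \<circ> chart_inv c) (fst z), frechet_derivative (snd d \<circ> chart_inv c) (at (fst z)) (snd z))"
proof -
  obtain p v where pv: "(p, v) \<in> fst (induced_chart A c)" "(p, v) \<in> fst (induced_chart A d)"
    "z = snd (induced_chart A c) (p, v)"
    using z unfolding induced_chart_image[OF A c d, symmetric] by auto
  have "chart_inv (induced_chart A c) z = (p, v)"
    using induced_chart_inj[OF A c] pv unfolding chart_inv_def by simp
  then show ?thesis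
    using pv tangent_space_transition[OF _ c d, of v p] chart_inv_apply[OF A c, of p]
    unfolding induced_chart_mem induced_chart_apply by (simp add: induced_chart_apply)
qed

text \<open>The derivative of \<open>(x, y) \<mapsto> (\<tau> x, D\<tau>(x) y)\<close> is block triangular with equal diagonal blocks
  \<open>D\<tau>(x)\<close>. Only this shape matters below, so the second-order block \<open>B\<close> stays anonymous.\<close>

lemma induced_transition_derivative:
  assumes A: "compatible_atlas A" and c: "c \<in> A" and d: "d \<in> A"
    and smooth: "smooth_on (snd c ` (fst c \<inter> fst d)) (snd d \<circ> chart_inv c)"
    and z: "z \<in> snd c ` (fst c \<inter> fst d) \<times> (- {0})"
  shows "\<exists>B. ((snd (induced_chart A d) \<circ> chart_inv (induced_chart A c)) has_derivative
    (\<lambda>h. (frechet_derivative (snd d \<circ> chart_inv c) (at (fst z)) (fst h),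
          B (fst h) + frechet_derivative (snd d \<circ> chart_inv c) (at (fst z)) (snd h)))) (at z)
    \<and> B 0 = 0"
proof -
  let ?U = "snd c ` (fst c \<inter> fst d)"
  let ?t = "snd d \<circ> chart_inv c"
  let ?D = "\<lambda>b x. frechet_derivative ?t (at x) b"
  have x: "fst z \<in> ?U" using z by auto
  \<comment> \<open>\<open>D\<tau>(x) y\<close> becomes a finite sum of products, so that the product rule applies\<close>
  have expand: "?D v x = (\<Sum>b\<in>Basis. (v \<bullet> b) *\<^sub>R ?D b x)" if "x \<in> ?U" for v x
    by (rule frechet_derivative_expand[OF smooth_on_differentiable[OF smooth that]])
  define B where "B = (\<lambda>h. \<Sum>b\<in>Basis. (snd z \<bullet> b) *\<^sub>R frechet_derivative (?D b) (at (fst z)) h)"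
  have D: "((\<lambda>z. g (fst z)) has_derivative (\<lambda>h. frechet_derivative g (at (fst z)) (fst h))) (at z)"
    if "smooth_on ?U g" for g :: "real^2 \<Rightarrow> real^2"
    using diff_chain_at[of fst fst z g, OF has_derivative_fst[OF has_derivative_ident] smooth_on_has_derivative[OF that x]]
    by (simp add: o_def)
  have "((\<lambda>z. (?t (fst z), \<Sum>b\<in>Basis. (snd z \<bullet> b) *\<^sub>R ?D b (fst z))) has_derivative
     (\<lambda>h. (?D (fst h) (fst z), \<Sum>b\<in>Basis. (snd z \<bullet> b) *\<^sub>R frechet_derivative (?D b) (at (fst z)) (fst h)
        + (snd h \<bullet> b) *\<^sub>R ?D b (fst z)))) (at z)"
    by (intro has_derivative_Pair D smooth has_derivative_sum has_derivative_scaleR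
        smooth_on_frechet_derivative has_derivative_inner_left has_derivative_snd has_derivative_ident)
  also have "(\<lambda>h. (?D (fst h) (fst z), \<Sum>b\<in>Basis. (snd z \<bullet> b) *\<^sub>R frechet_derivative (?D b) (at (fst z)) (fst h)
        + (snd h \<bullet> b) *\<^sub>R ?D b (fst z))) = (\<lambda>h. (?D (fst h) (fst z), B (fst h) + ?D (snd h) (fst z)))"
    unfolding sum.distrib B_def by (subst (3) expand[OF x]) simp
  finally have "((\<lambda>z. (?t (fst z), \<Sum>b\<in>Basis. (snd z \<bullet> b) *\<^sub>R ?D b (fst z))) has_derivative
     (\<lambda>h. (?D (fst h) (fst z), B (fst h) + ?D (snd h) (fst z)))) (at z)" .
  then have "((snd (induced_chart A d) \<circ> chart_inv (induced_chart A c)) has_derivative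
     (\<lambda>h. (?D (fst h) (fst z), B (fst h) + ?D (snd h) (fst z)))) (at z)"
  proof (rule has_derivative_transform_within_open)
    show "open (?U \<times> (- {0}) :: coords set)"
      by (intro open_Times compatible_atlas_open_Int[OF A c d]) auto
    show "z \<in> ?U \<times> - {0}" by (rule z)
    show "(?t (fst w), \<Sum>b\<in>Basis. (snd w \<bullet> b) *\<^sub>R ?D b (fst w)) =
      (snd (induced_chart A d) \<circ> chart_inv (induced_chart A c)) w" if "w \<in> ?U \<times> - {0}" for w
      unfolding induced_transition[OF A c d that] using that by (subst expand[of _ "snd w"]) auto
  qed
  moreover have "B 0 = 0"
  proof -
    have "frechet_derivative (?D b) (at (fst z)) 0 = 0" for b
      by (intro linear_0 linear_frechet_derivative smooth_on_differentiable[OF smooth_on_frechet_derivative[OF smooth] x])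
    then show ?thesis by (simp add: B_def)
  qed
  ultimately show ?thesis by blast
qed

lemma smooth_manifold_transition:
  "smooth_manifold M A \<Longrightarrow> c \<in> A \<Longrightarrow> d \<in> A \<Longrightarrow> smooth_on (snd c ` (fst c \<inter> fst d)) (snd d \<circ> chart_inv c)"
  unfolding smooth_manifold_def by blast

lemma compatible_slit_atlas:
  fixes A :: "('a, real^2) chart set"
  assumes M: "smooth_manifold M A"
  shows "compatible_atlas (slit_atlas A)"
proof -
  note A = smooth_manifold_compatible_atlas[OF M]
  have "open (snd (induced_chart A c) ` (fst (induced_chart A c) \<inter> fst (induced_chart A d)))"
    if c: "c \<in> A" and d: "d \<in> A" for c d
    unfolding induced_chart_image[OF A c d]
    by (intro open_Times compatible_atlas_open_Int[OF A c d]) auto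
  moreover have "(snd (induced_chart A d) \<circ> chart_inv (induced_chart A c)) differentiable (at z)"
    if c: "c \<in> A" and d: "d \<in> A"
      and z: "z \<in> snd (induced_chart A c) ` (fst (induced_chart A c) \<inter> fst (induced_chart A d))" for c d z
    using induced_transition_derivative[OF A c d smooth_manifold_transition[OF M c d], of z] z
    unfolding induced_chart_image[OF A c d] differentiable_def by blast
  ultimately show ?thesis
    unfolding compatible_atlas_def slit_atlas_def using induced_chart_inj[OF A] by blast
qed

text \<open>The operation \<open>(a, b) \<mapsto> (0, a)\<close> commutes with every block triangular matrix whose diagonal
  blocks agree, so it does not depend on the chart.\<close>

lemma vert_tangent:
  fixes A :: "('a, real^2) chart set"
  assumes M: "smooth_manifold M A" and w: "w \<in> tangent_space (slit_atlas A) u"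
  shows "vert w \<in> tangent_space (slit_atlas A) u"
proof -
  note A = smooth_manifold_compatible_atlas[OF M]
  have "vert w l = frechet_derivative (snd l \<circ> chart_inv k) (at (snd k u)) (vert w k)"
    if k: "k \<in> slit_atlas A" "u \<in> fst k" and l: "l \<in> slit_atlas A" "u \<in> fst l" for k l
  proof -
    obtain c d where c: "c \<in> A" "k = induced_chart A c" and d: "d \<in> A" "l = induced_chart A d"
      using k l unfolding slit_atlas_def by auto
    let ?D = "frechet_derivative (snd d \<circ> chart_inv c) (at (fst (snd k u)))"
    have "snd k u \<in> snd k ` (fst k \<inter> fst l)" using k l by blast
    then have z: "snd k u \<in> snd c ` (fst c \<inter> fst d) \<times> (- {0})"
      unfolding c(2) d(2) induced_chart_image[OF A c(1) d(1)] .
    obtain B where B: "((snd l \<circ> chart_inv k) has_derivative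
        (\<lambda>h. (?D (fst h), B (fst h) + ?D (snd h)))) (at (snd k u))" and B0: "B 0 = 0"
      using induced_transition_derivative[OF A c(1) d(1) smooth_manifold_transition[OF M c(1) d(1)] z]
      unfolding c(2) d(2) by blast
    have D0: "?D 0 = 0"
      using z by (intro linear_0 linear_frechet_derivative
          smooth_on_differentiable[OF smooth_manifold_transition[OF M c(1) d(1)]]) auto
    have "fst (w l) = ?D (fst (w k))"
      using tangent_space_transition[OF w k(1) l(1) k(2) l(2)] frechet_derivative_eq[OF B] by simp
    then show ?thesis
      unfolding frechet_derivative_eq[OF B] by (simp add: vert_def B0 D0)
  qed
  moreover have "vert w k = 0" if "k \<notin> slit_atlas A \<or> u \<notin> fst k" for k
    using tangent_space_outside[OF w that] by (simp add: vert_def zero_prod_def)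
  ultimately show ?thesis unfolding tangent_space_def by blast
qed

lemma vector_field_vert_field:
  fixes A :: "('a, real^2) chart set"
  assumes M: "smooth_manifold M A" and X: "vector_field (slit_atlas A) X"
  shows "vector_field (slit_atlas A) (vert_field X)"
  unfolding vector_field_def
proof (intro conjI ballI)
  show "vert_field X u \<in> tangent_space (slit_atlas A) u" if "u \<in> charted_space (slit_atlas A)" for u
    using that X vert_tangent[OF M] unfolding vert_field_def vector_field_def by blast
  fix k assume k: "k \<in> slit_atlas A"
  have "bounded_linear (\<lambda>w :: coords. (0 :: real^2, fst w))"
    by (intro bounded_linear_Pair bounded_linear_zero bounded_linear_fst)
  from smooth_on_bounded_linear[OF compatible_atlas_open[OF compatible_slit_atlas[OF M] k] this vector_field_smooth[OF X k]]
  show "smooth_on (snd k ` fst k) (field_rep (vert_field X) k)"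
    by (simp add: field_rep_def vert_field_def vert_def)
qed

theorem proposition5p3:
  fixes M :: "'a topology" and A :: "('a, real^2) chart set"
    and F K \<I> \<J> \<rho> \<F> :: "'a tpoint \<Rightarrow> real"
    and S H V :: "'a tfield"
  assumes "smooth_manifold M A"
    and "finsler_function A F"
    and "geodesic_spray A F S"
    and "flag_curvature A F S K"
    and nonflat: "\<forall>u\<in>slit_bundle A. K u \<noteq> 0"
    and "berwald_frame A F S K H \<I> \<J>"
  defines "V \<equiv> vert_field H"
    and "\<rho> \<equiv> ricci_scalar F K"
    and "\<F> \<equiv> (\<lambda>u. field_deriv (slit_atlas A) H \<I> u + field_deriv (slit_atlas A) V \<J> u)"
  assumes "\<forall>u\<in>slit_bundle A. field_deriv (slit_atlas A) V \<rho> u = 0"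
  shows "first_integral A S \<F> \<and>
    (\<forall>u\<in>slit_bundle A. field_deriv (slit_atlas A) S \<J> u = - \<I> u * \<rho> u)"
proof -
  let ?T = "slit_atlas A"
  note T = compatible_slit_atlas[OF assms(1)]
  have S: "vector_field ?T S" using assms(3) by (simp add: geodesic_spray_def)
  have H: "vector_field ?T H" and I: "smooth_fun ?T \<I>"
    and frame: "\<And>u. u \<in> slit_bundle A \<Longrightarrow>
      lie_bracket ?T S H u = (\<lambda>\<kappa>. \<rho> u *\<^sub>R V u \<kappa>) \<and> lie_bracket ?T V S u = H u \<and>
      lie_bracket ?T H V u = (\<lambda>\<kappa>. S u \<kappa> + \<I> u *\<^sub>R H u \<kappa> + \<J> u *\<^sub>R V u \<kappa>) \<and>
      \<J> u = field_deriv ?T S \<I> u"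
    and indep: "\<And>u a b c d. u \<in> slit_bundle A \<Longrightarrow>
      (\<forall>\<kappa>. a *\<^sub>R H u \<kappa> + b *\<^sub>R S u \<kappa> + c *\<^sub>R V u \<kappa> + d *\<^sub>R liouville A u \<kappa> = 0) \<Longrightarrow> c = 0"
    using assms(6) unfolding berwald_frame_def Let_def V_def \<rho>_def by simp_all
  have V: "vector_field ?T V" unfolding V_def by (rule vector_field_vert_field[OF assms(1) H])
  have \<rho>: "smooth_fun ?T \<rho>"
  proof -
    have "smooth_fun ?T (\<lambda>u. K u * (F u * F u))"
      using assms(2,4) unfolding finsler_function_def flag_curvature_def
      by (intro smooth_fun_mult T) auto
    then show ?thesis by (simp add: \<rho>_def ricci_scalar_def[abs_def] power2_eq_square)
  qed
  have J: "smooth_fun ?T \<J>"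
    by (rule smooth_fun_cong[OF T smooth_fun_field_deriv[OF T S I]])
      (use frame in \<open>simp add: slit_bundle_def\<close>)
  have \<F>: "smooth_fun ?T \<F>"
    unfolding \<F>_def by (intro smooth_fun_add smooth_fun_field_deriv T H V I J)
  have in_bundle: "chart_inv \<kappa> z \<in> slit_bundle A" if "\<kappa> \<in> ?T" "z \<in> snd \<kappa> ` fst \<kappa>" for \<kappa> z
    using chart_inv_mem[OF that(2)] that(1) unfolding slit_bundle_def charted_space_def by blast
  note smooth_in_chart = compatible_atlas_open[OF T] vector_field_smooth[OF S] vector_field_smooth[OF H]
    vector_field_smooth[OF V] smooth_fun_smooth[OF I] smooth_fun_smooth[OF \<rho>]
  have J_eq: "(\<J> \<circ> chart_inv \<kappa>) z = derive_along (field_rep S \<kappa>) (\<I> \<circ> chart_inv \<kappa>) z"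
    if "\<kappa> \<in> ?T" "z \<in> snd \<kappa> ` fst \<kappa>" for \<kappa> z
    using frame[OF in_bundle[OF that]] field_deriv_in_chart[OF T S I that] by simp
  have SH: "bracket (field_rep S \<kappa>) (field_rep H \<kappa>) z = (\<rho> \<circ> chart_inv \<kappa>) z *\<^sub>R field_rep V \<kappa> z"
    if "\<kappa> \<in> ?T" "z \<in> snd \<kappa> ` fst \<kappa>" for \<kappa> z
    using frame[OF in_bundle[OF that]] lie_bracket_in_chart[OF that, of S H] by (simp add: field_rep_def)
  have VS: "bracket (field_rep V \<kappa>) (field_rep S \<kappa>) z = field_rep H \<kappa> z"
    if "\<kappa> \<in> ?T" "z \<in> snd \<kappa> ` fst \<kappa>" for \<kappa> z
    using frame[OF in_bundle[OF that]] lie_bracket_in_chart[OF that, of V S] by (simp add: field_rep_def)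
  have HV: "bracket (field_rep H \<kappa>) (field_rep V \<kappa>) z = field_rep S \<kappa> z
      + (\<I> \<circ> chart_inv \<kappa>) z *\<^sub>R field_rep H \<kappa> z + (\<J> \<circ> chart_inv \<kappa>) z *\<^sub>R field_rep V \<kappa> z"
    if "\<kappa> \<in> ?T" "z \<in> snd \<kappa> ` fst \<kappa>" for \<kappa> z
    using frame[OF in_bundle[OF that]] lie_bracket_in_chart[OF that, of H V] by (simp add: field_rep_def)
  have V\<rho>: "derive_along (field_rep V \<kappa>) (\<rho> \<circ> chart_inv \<kappa>) z = 0"
    if "\<kappa> \<in> ?T" "z \<in> snd \<kappa> ` fst \<kappa>" for \<kappa> z
    using assms(10) in_bundle[OF that] field_deriv_in_chart[OF T V \<rho> that] by metis
  \<comment> \<open>the local Jacobi identity holds in every chart around \<open>u\<close> with the same scalar coefficient, hence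
    it is an identity of tangent vectors, to which the independence of the frame applies\<close>
  have SJ: "field_deriv ?T S \<J> u = - \<I> u * \<rho> u" if u: "u \<in> slit_bundle A" for u
  proof -
    let ?a = "\<I> u * \<rho> u + field_deriv ?T S \<J> u"
    have "?a *\<^sub>R V u \<kappa> = 0" for \<kappa>
    proof (cases "\<kappa> \<in> ?T \<and> u \<in> fst \<kappa>")
      case True
      then have \<kappa>: "\<kappa> \<in> ?T" "snd \<kappa> u \<in> snd \<kappa> ` fst \<kappa>" and u': "chart_inv \<kappa> (snd \<kappa> u) = u"
        using chart_inv_apply[OF T] by auto
      have "((\<I> \<circ> chart_inv \<kappa>) (snd \<kappa> u) * (\<rho> \<circ> chart_inv \<kappa>) (snd \<kappa> u)
          + derive_along (field_rep S \<kappa>) (\<J> \<circ> chart_inv \<kappa>) (snd \<kappa> u)) *\<^sub>R field_rep V \<kappa> (snd \<kappa> u) = 0"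
        by (rule structure_equations_Jacobi[OF smooth_in_chart[OF \<kappa>(1)]
              J_eq[OF \<kappa>(1)] SH[OF \<kappa>(1)] VS[OF \<kappa>(1)] HV[OF \<kappa>(1)] V\<rho>[OF \<kappa>] \<kappa>(2)])
      then show ?thesis
        using field_deriv_in_chart[OF T S J \<kappa>] by (simp add: u' field_rep_def)
    next
      case False
      have "V u \<in> tangent_space ?T u"
        using V u unfolding vector_field_def slit_bundle_def by blast
      from tangent_space_outside[OF this, of \<kappa>] show ?thesis using False by auto
    qed
    then have "?a = 0" using indep[OF u, of 0 0 ?a 0] by simp
    then show ?thesis by simp
  qed
  have "field_deriv ?T S \<F> u = 0" if u: "u \<in> slit_bundle A" for u
  proof -
    obtain \<kappa> where "\<kappa> \<in> ?T" "u \<in> fst \<kappa>" using u unfolding slit_bundle_def charted_space_def by blast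
    then have \<kappa>: "\<kappa> \<in> ?T" "snd \<kappa> u \<in> snd \<kappa> ` fst \<kappa>" and u': "chart_inv \<kappa> (snd \<kappa> u) = u"
      using chart_inv_apply[OF T] by auto
    note in_chart = field_deriv_in_chart[OF T _ _ \<kappa>(1)]
    have SJ': "derive_along (field_rep S \<kappa>) (\<J> \<circ> chart_inv \<kappa>) z = - (\<I> \<circ> chart_inv \<kappa>) z * (\<rho> \<circ> chart_inv \<kappa>) z"
      if "z \<in> snd \<kappa> ` fst \<kappa>" for z
      using SJ[OF in_bundle[OF \<kappa>(1) that]] in_chart[OF S J that] by simp
    have "field_deriv ?T S \<F> u = derive_along (field_rep S \<kappa>) (\<F> \<circ> chart_inv \<kappa>) (snd \<kappa> u)"
      using in_chart[OF S \<F> \<kappa>(2)] u' by simp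
    also have "\<dots> = derive_along (field_rep S \<kappa>)
        (\<lambda>z. derive_along (field_rep H \<kappa>) (\<I> \<circ> chart_inv \<kappa>) z
           + derive_along (field_rep V \<kappa>) (\<J> \<circ> chart_inv \<kappa>) z) (snd \<kappa> u)"
      by (rule derive_along_cong[OF compatible_atlas_open[OF T \<kappa>(1)] \<kappa>(2)])
        (simp add: \<F>_def in_chart[OF H I] in_chart[OF V J])
    also have "\<dots> = 0"
      by (rule structure_equations_first_integral[OF smooth_in_chart[OF \<kappa>(1)]
            J_eq[OF \<kappa>(1)] SH[OF \<kappa>(1)] VS[OF \<kappa>(1)] SJ' V\<rho>[OF \<kappa>] \<kappa>(2)])
    finally show ?thesis .
  qed
  then show ?thesis using \<F> SJ unfolding first_integral_def by blast
qed

end
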